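(* Assume the standing setting and assumption in the context. There exist constants $C_7,C_8,C_9,C_3'>0$ such that for any Borel set $B\subset\mathbb R$ with $\mu(B)>0$ there exists $N\in\mathbb N$ such that for all $s>C_7$, $$\mathbb P\Big(\sup_{x\in\mathbb Z^d:\,|x|_1\ge N}\ \max_{\pi\in\mathrm{Geo}(0,x)}\nu^\pi(B) > s\,\mu(B)^{1/d}\Big)\ \le\ C_8 e^{-C_9 s}.$$ Moreover, $$\mathbb E\Big[\sup_{x\in\mathbb Z^d:\,|x|_1\ge N}\ \max_{\pi\in\mathrm{Geo}(0,x)}\nu^\pi(B)\Big]\ \le\ C_3'\,\mu(B)^{1/d}.$$
   Context: Setting: $d\ge2$; $\mathcal E^d$ nearest-neighbor edges of $\mathbb Z^d$; $\{\tau_e\}$ i.i.d. non-negative with law $\mu$, distribution function $F$, essential infimum $r$. Standing assumption: $F(r)<p_c(d)$ if $r=0$ and $F(r)<\vec p_c(d)$ if $r>0$ ($p_c(d)$, $\vec p_c(d)$: critical probabilities of Bernoulli bond and oriented bond percolation on $\mathbb Z^d$). $T(\gamma)=\sum_{e\in\gamma}\tau_e$; $T(x,y)$ is the infimum over vertex self-avoiding paths from $x$ to $y$; a geodesic attains it; $\mathrm{Geo}(0,x)$ is the set of geodesics from $0$ to $x$. For a geodesic $\pi$ with $|\pi|$ edges, $\nu^\pi(B)=\frac1{|\pi|}\#\{e\in\pi:\tau_e\in B\}$. *)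

theory Defs
  imports "HOL-Probability.Probability"
begin

text \<open>Vertices of Z^d are functions nat => int vanishing at coordinates i >= d.
  Edges are two-element sets of nearest neighbours.\<close>

type_synonym vtx = "nat \<Rightarrow> int"
type_synonym edge = "vtx set"

definition lattice :: "nat \<Rightarrow> vtx set" where
  "lattice d = {x. \<forall>i\<ge>d. x i = 0}"

definition l1 :: "nat \<Rightarrow> vtx \<Rightarrow> int" where
  "l1 d x = (\<Sum>i<d. \<bar>x i\<bar>)"

definition origin :: vtx where
  "origin = (\<lambda>_. 0)"

definition nn :: "nat \<Rightarrow> vtx \<Rightarrow> vtx \<Rightarrow> bool" where
  "nn d x y \<longleftrightarrow> x \<in> lattice d \<and> y \<in> lattice d \<and> l1 d (\<lambda>i. x i - y i) = 1"

definition edges :: "nat \<Rightarrow> edge set" where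
  "edges d = {{x, y} | x y. nn d x y}"

definition is_path :: "nat \<Rightarrow> vtx list \<Rightarrow> bool" where
  "is_path d p \<longleftrightarrow> p \<noteq> [] \<and> distinct p \<and> set p \<subseteq> lattice d \<and>
     (\<forall>i. Suc i < length p \<longrightarrow> nn d (p ! i) (p ! Suc i))"

definition paths :: "nat \<Rightarrow> vtx \<Rightarrow> vtx \<Rightarrow> vtx list set" where
  "paths d x y = {p. is_path d p \<and> hd p = x \<and> last p = y}"

definition path_T :: "(edge \<Rightarrow> real) \<Rightarrow> vtx list \<Rightarrow> real" where
  "path_T t p = (\<Sum>i<length p - 1. t {p ! i, p ! Suc i})"

definition passage_time :: "nat \<Rightarrow> (edge \<Rightarrow> real) \<Rightarrow> vtx \<Rightarrow> vtx \<Rightarrow> real" where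
  "passage_time d t x y = Inf (path_T t ` paths d x y)"

definition geodesics :: "nat \<Rightarrow> (edge \<Rightarrow> real) \<Rightarrow> vtx \<Rightarrow> vtx \<Rightarrow> vtx list set" where
  "geodesics d t x y = {p \<in> paths d x y. path_T t p = passage_time d t x y}"

definition emp :: "(edge \<Rightarrow> real) \<Rightarrow> vtx list \<Rightarrow> real set \<Rightarrow> real" where
  "emp t p B = real (card {i. Suc i < length p \<and> t {p ! i, p ! Suc i} \<in> B}) / real (length p - 1)"

definition Zsup :: "nat \<Rightarrow> (edge \<Rightarrow> real) \<Rightarrow> nat \<Rightarrow> real set \<Rightarrow> ereal" where
  "Zsup d t N B = (SUP x\<in>{x \<in> lattice d. int N \<le> l1 d x}.
                     SUP p\<in>geodesics d t origin x. ereal (emp t p B))"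

definition bern :: "nat \<Rightarrow> real \<Rightarrow> (edge \<Rightarrow> bool) measure" where
  "bern d p = PiM (edges d) (\<lambda>_. measure_pmf (bernoulli_pmf p))"

definition open_cluster :: "nat \<Rightarrow> (edge \<Rightarrow> bool) \<Rightarrow> vtx set" where
  "open_cluster d \<omega> = {y. \<exists>p\<in>paths d origin y.
       \<forall>i. Suc i < length p \<longrightarrow> \<omega> {p ! i, p ! Suc i}}"

definition theta :: "nat \<Rightarrow> real \<Rightarrow> real" where
  "theta d p = measure (bern d p) {\<omega> \<in> space (bern d p). infinite (open_cluster d \<omega>)}"

definition p_c :: "nat \<Rightarrow> real" where
  "p_c d = Sup {p \<in> {0..1}. theta d p = 0}"

definition ostep :: "nat \<Rightarrow> vtx \<Rightarrow> vtx \<Rightarrow> bool" where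
  "ostep d x y \<longleftrightarrow> x \<in> lattice d \<and> (\<exists>i<d. y = x(i := x i + 1))"

definition oriented_cluster :: "nat \<Rightarrow> (edge \<Rightarrow> bool) \<Rightarrow> vtx set" where
  "oriented_cluster d \<omega> = {y. \<exists>p. p \<noteq> [] \<and> hd p = origin \<and> last p = y \<and>
       (\<forall>i. Suc i < length p \<longrightarrow> ostep d (p ! i) (p ! Suc i) \<and> \<omega> {p ! i, p ! Suc i})}"

definition otheta :: "nat \<Rightarrow> real \<Rightarrow> real" where
  "otheta d p = measure (bern d p) {\<omega> \<in> space (bern d p). infinite (oriented_cluster d \<omega>)}"

definition vp_c :: "nat \<Rightarrow> real" where
  "vp_c d = Sup {p \<in> {0..1}. otheta d p = 0}"

definition ess_inf_law :: "real measure \<Rightarrow> real" where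
  "ess_inf_law \<mu> = Sup {t. measure \<mu> {..<t} = 0}"

definition cdf :: "real measure \<Rightarrow> real \<Rightarrow> real" where
  "cdf \<mu> t = measure \<mu> {..t}"

end

theory Submission
  imports Defs
begin

text \<open>
  The bound holds for all self-avoiding paths from the origin, geodesic or not. Put
  \<open>q = (\<mu> B) powr (1/d)\<close> and observe a path with \<open>n\<close> edges only at every \<open>l\<close>-th vertex and at
  resolution \<open>l \<approx> 1/q\<close>: what remains is a walk of at most \<open>n q\<close> steps in \<open>{-1, 0, 1}\<^sup>d\<close>, so there are at
  most \<open>3^(d n q)\<close> possibilities. The walk confines the path to \<open>n q + 1\<close> balls of radius \<open>2 l\<close>, and
  such a ball meets \<open>O(1)\<close> edges with weight in \<open>B\<close> on average. A Chernoff bound for each walk, a union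
  bound over the walks and a geometric series over \<open>n \<ge> N\<close> give the exponential tail; \<open>N\<close> of order
  \<open>1/q\<close>, up to a logarithm, makes the constants independent of \<open>B\<close>.
\<close>

section \<open>Sup-norm balls and incident edges\<close>

definition sup_ball :: "nat \<Rightarrow> vtx \<Rightarrow> nat \<Rightarrow> vtx set" where
  "sup_ball d x r = {y \<in> lattice d. \<forall>i<d. \<bar>y i - x i\<bar> \<le> int r}"

definition incident :: "nat \<Rightarrow> vtx set \<Rightarrow> edge set" where
  "incident d W = {e \<in> edges d. e \<inter> W \<noteq> {}}"

lemma sup_ball_eq_PiE_dflt: "sup_ball d x r = PiE_dflt {..<d} 0 (\<lambda>i. {x i - int r..x i + int r})"
  by (auto simp: sup_ball_def PiE_dflt_def lattice_def abs_le_iff not_less)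

lemma finite_sup_ball: "finite (sup_ball d x r)"
  unfolding sup_ball_eq_PiE_dflt by (rule finite_PiE_dflt) auto

lemma card_sup_ball: "card (sup_ball d x r) = (2 * r + 1) ^ d"
proof -
  have "card {x i - int r..x i + int r} = 2 * r + 1" for i
    by simp
  then show ?thesis
    unfolding sup_ball_eq_PiE_dflt by (subst card_PiE_dflt) auto
qed

lemma mem_sup_ballI:
  assumes "y \<in> lattice d" "l1 d (\<lambda>i. y i - x i) \<le> int r"
  shows "y \<in> sup_ball d x r"
proof -
  have "\<bar>y i - x i\<bar> \<le> l1 d (\<lambda>i. y i - x i)" if "i < d" for i
    unfolding l1_def using that by (intro member_le_sum) auto
  with assms show ?thesis
    by (force simp: sup_ball_def)
qed

lemma nn_commute: "nn d x y \<longleftrightarrow> nn d y x"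
  by (auto simp: nn_def l1_def abs_minus_commute)

lemma nn_imp_mem_sup_ball: "nn d x y \<Longrightarrow> y \<in> sup_ball d x 1"
  by (rule mem_sup_ballI) (auto simp: nn_commute[of d x y] nn_def[of d y x])

lemma incident_subset: "incident d W \<subseteq> (\<Union>x\<in>W. (\<lambda>y. {x, y}) ` sup_ball d x 1)"
proof
  fix e assume "e \<in> incident d W"
  then obtain x y where "e = {x, y}" "nn d x y" "x \<in> W"
    unfolding incident_def edges_def using nn_commute by blast
  then show "e \<in> (\<Union>x\<in>W. (\<lambda>y. {x, y}) ` sup_ball d x 1)"
    using nn_imp_mem_sup_ball by blast
qed

lemma finite_incident: "finite W \<Longrightarrow> finite (incident d W)"
  by (rule finite_subset[OF incident_subset]) (simp add: finite_sup_ball)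

lemma card_incident_le:
  assumes "finite W"
  shows "card (incident d W) \<le> card W * 3 ^ d"
proof -
  have "card (incident d W) \<le> card (\<Union>x\<in>W. (\<lambda>y. {x, y}) ` sup_ball d x 1)"
    using assms by (intro card_mono incident_subset) (simp add: finite_sup_ball)
  also have "\<dots> \<le> (\<Sum>x\<in>W. card ((\<lambda>y. {x, y}) ` sup_ball d x 1))"
    using assms by (rule card_UN_le)
  also have "\<dots> \<le> (\<Sum>x\<in>W. 3 ^ d)"
    using card_image_le[OF finite_sup_ball[of d _ 1]] by (intro sum_mono) (simp add: card_sup_ball)
  finally show ?thesis by simp
qed

section \<open>Paths and their hits\<close>

definition origin_paths :: "nat \<Rightarrow> nat \<Rightarrow> vtx list set" where
  "origin_paths d n = {p. is_path d p \<and> hd p = origin \<and> length p = Suc n}"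

definition hits :: "(edge \<Rightarrow> real) \<Rightarrow> vtx list \<Rightarrow> real set \<Rightarrow> nat set" where
  "hits t p B = {i \<in> {..<length p - 1}. t {p ! i, p ! Suc i} \<in> B}"

lemma emp_eq_card_hits: "emp t p B = real (card (hits t p B)) / real (length p - 1)"
proof -
  have "hits t p B = {i. Suc i < length p \<and> t {p ! i, p ! Suc i} \<in> B}"
    by (auto simp: hits_def)
  then show ?thesis by (simp add: emp_def)
qed

lemma card_hits_le_length: "card (hits t p B) \<le> length p - 1"
proof -
  have "hits t p B \<subseteq> {..<length p - 1}" by (auto simp: hits_def)
  from card_mono[OF _ this] show ?thesis by simp
qed

lemma emp_le_1: "emp t p B \<le> 1"
  unfolding emp_eq_card_hits using card_hits_le_length[of t p B]
  by (cases "length p - 1 = 0") (auto simp: divide_le_eq_1)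

lemma Zsup_le_1: "Zsup d t N B \<le> 1"
  unfolding Zsup_def by (intro SUP_least) (simp add: emp_le_1 flip: one_ereal_def)

lemma path_edge_in_edges:
  assumes "is_path d p" "Suc i < length p"
  shows "{p ! i, p ! Suc i} \<in> edges d"
  using assms by (auto simp: is_path_def edges_def)

lemma inj_on_path_edges:
  assumes "distinct p"
  shows "inj_on (\<lambda>i. {p ! i, p ! Suc i}) {..<length p - 1}"
  using assms by (auto intro!: inj_onI simp: doubleton_eq_iff nth_eq_iff_index_eq)

lemma card_hits_le:
  assumes "is_path d p" "set p \<subseteq> W" "finite W"
  shows "card (hits t p B) \<le> card {e \<in> incident d W. t e \<in> B}"
proof (rule card_inj_on_le)
  have "distinct p" using assms(1) by (simp add: is_path_def)
  then show "inj_on (\<lambda>i. {p ! i, p ! Suc i}) (hits t p B)"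
    by (rule inj_on_subset[OF inj_on_path_edges]) (auto simp: hits_def)
  show "(\<lambda>i. {p ! i, p ! Suc i}) ` hits t p B \<subseteq> {e \<in> incident d W. t e \<in> B}"
    using assms(2) path_edge_in_edges[OF assms(1)] by (fastforce simp: incident_def hits_def)
  show "finite {e \<in> incident d W. t e \<in> B}"
    using finite_incident[OF assms(3)] by simp
qed

lemma l1_path_diff_le:
  assumes "is_path d p" "i \<le> j" "j < length p"
  shows "l1 d (\<lambda>c. (p ! j) c - (p ! i) c) \<le> int (j - i)"
  using assms(2,3)
proof (induction j rule: dec_induct)
  case base
  then show ?case by (simp add: l1_def)
next
  case (step j)
  have "l1 d (\<lambda>c. (p ! Suc j) c - (p ! i) c)
      \<le> l1 d (\<lambda>c. (p ! j) c - (p ! Suc j) c) + l1 d (\<lambda>c. (p ! j) c - (p ! i) c)"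
    unfolding l1_def sum.distrib[symmetric] by (rule sum_mono) linarith
  also have "l1 d (\<lambda>c. (p ! j) c - (p ! Suc j) c) = 1"
    using assms(1) step.prems by (auto simp: is_path_def nn_def)
  also have "1 + l1 d (\<lambda>c. (p ! j) c - (p ! i) c) \<le> int (Suc j - i)"
    using step by simp
  finally show ?case by simp
qed

lemma path_nth_mem_sup_ball:
  assumes "is_path d p" "i \<le> j" "j < length p" "j - i \<le> r"
  shows "p ! j \<in> sup_ball d (p ! i) r"
proof (rule mem_sup_ballI)
  show "p ! j \<in> lattice d"
    using assms(1,3) nth_mem by (fastforce simp: is_path_def)
  show "l1 d (\<lambda>c. (p ! j) c - (p ! i) c) \<le> int r"
    using l1_path_diff_le[OF assms(1-3)] assms(4) by simp
qed

lemma l1_le_path_length: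
  assumes "p \<in> paths d origin x"
  shows "l1 d x \<le> int (length p - 1)"
proof -
  have p: "is_path d p" "p \<noteq> []" "p ! 0 = origin" "p ! (length p - 1) = x"
    using assms by (auto simp: paths_def is_path_def hd_conv_nth last_conv_nth)
  from l1_path_diff_le[OF p(1), of 0 "length p - 1"] p(2-4) show ?thesis
    by (simp add: origin_def)
qed

section \<open>Coarse-graining of paths\<close>

text \<open>
  A coarse walk starts at the origin and is encoded by the list of its increments, which makes it
  easy to count; partial sums recover its sites.
\<close>

definition coarse_walks :: "nat \<Rightarrow> nat \<Rightarrow> vtx list set" where
  "coarse_walks d r = {zs. set zs \<subseteq> sup_ball d origin 1 \<and> length zs = r}"

definition coarse_region :: "nat \<Rightarrow> nat \<Rightarrow> vtx list \<Rightarrow> vtx set" where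
  "coarse_region d l zs = (\<Union>k\<le>length zs. sup_ball d (\<lambda>i. int l * (\<Sum>j<k. (zs ! j) i)) (2 * l))"

definition coarse_steps :: "nat \<Rightarrow> vtx list \<Rightarrow> vtx list" where
  "coarse_steps l p = map (\<lambda>k i. (p ! (Suc k * l)) i div int l - (p ! (k * l)) i div int l)
     [0..<(length p - 1) div l]"

lemma finite_coarse_walks: "finite (coarse_walks d r)"
  unfolding coarse_walks_def by (intro finite_lists_length_eq finite_sup_ball)

lemma card_coarse_walks: "card (coarse_walks d r) = 3 ^ (d * r)"
  unfolding coarse_walks_def
  by (simp add: card_lists_length_eq finite_sup_ball card_sup_ball power_mult)

lemma finite_coarse_region: "finite (coarse_region d l zs)"
  unfolding coarse_region_def by (simp add: finite_sup_ball)

lemma card_coarse_region_le: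
  assumes "0 < l"
  shows "card (coarse_region d l zs) \<le> (length zs + 1) * (5 * l) ^ d"
proof -
  have "card (coarse_region d l zs) \<le> (\<Sum>k\<le>length zs. (4 * l + 1) ^ d)"
    unfolding coarse_region_def by (rule order_trans[OF card_UN_le]) (auto simp: card_sup_ball)
  also have "\<dots> \<le> (\<Sum>k\<le>length zs. (5 * l) ^ d)"
    using assms by (intro sum_mono power_mono) auto
  finally show ?thesis by simp
qed

lemma card_incident_coarse_region_le:
  assumes "0 < l"
  shows "card (incident d (coarse_region d l zs)) \<le> (length zs + 1) * (15 * l) ^ d"
proof -
  have "card (incident d (coarse_region d l zs)) \<le> card (coarse_region d l zs) * 3 ^ d"
    by (intro card_incident_le finite_coarse_region)
  also have "\<dots> \<le> (length zs + 1) * (5 * l) ^ d * 3 ^ d"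
    using card_coarse_region_le[OF assms] by (rule mult_right_mono) simp
  also have "\<dots> = (length zs + 1) * (5 * l * 3) ^ d"
    by (simp only: power_mult_distrib mult.assoc)
  also have "5 * l * 3 = 15 * l" by simp
  finally show ?thesis .
qed

lemma abs_div_diff_le_1:
  fixes x y l :: int
  assumes "\<bar>x - y\<bar> \<le> l" "0 < l"
  shows "\<bar>x div l - y div l\<bar> \<le> 1"
proof -
  have "x div l \<le> (y + l) div l" "y div l \<le> (x + l) div l"
    using assms by (intro zdiv_mono1; linarith)+
  then show ?thesis using assms by simp
qed

lemma div_diff_mem_sup_ball_1:
  assumes "y \<in> sup_ball d x l" "x \<in> lattice d" "0 < l"
  shows "(\<lambda>i. y i div int l - x i div int l) \<in> sup_ball d origin 1"
  using assms abs_div_diff_le_1[of _ _ "int l"] by (simp add: sup_ball_def lattice_def origin_def)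

lemma mem_sup_ball_div:
  assumes "y \<in> sup_ball d x l" "0 < l"
  shows "y \<in> sup_ball d (\<lambda>i. int l * (x i div int l)) (2 * l)"
proof -
  have "\<bar>y i - int l * (x i div int l)\<bar> \<le> int (2 * l)" if "i < d" for i
  proof -
    have "\<bar>y i - x i\<bar> \<le> int l"
      using assms(1) that by (simp add: sup_ball_def)
    moreover have "0 \<le> x i mod int l" "x i mod int l < int l"
      using assms(2) by auto
    moreover have "int l * (x i div int l) = x i - x i mod int l"
      by (simp add: minus_mod_eq_mult_div)
    ultimately show ?thesis by linarith
  qed
  with assms(1) show ?thesis by (simp add: sup_ball_def)
qed

lemma coarse_steps_in_coarse_walks:
  assumes "is_path d p" "0 < l"
  shows "coarse_steps l p \<in> coarse_walks d ((length p - 1) div l)"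
proof -
  have "(\<lambda>i. (p ! (Suc k * l)) i div int l - (p ! (k * l)) i div int l) \<in> sup_ball d origin 1"
    if "k < (length p - 1) div l" for k
  proof -
    have "Suc k * l \<le> length p - 1"
      using that assms(2) by (simp only: less_eq_div_iff_mult_less_eq[symmetric] Suc_le_eq)
    then have lt: "Suc k * l < length p"
      using assms(1) by (cases p) (auto simp: is_path_def)
    then have "p ! (k * l) \<in> lattice d"
      using assms(1) nth_mem[of "k * l" p] by (auto simp: is_path_def)
    with assms lt show ?thesis
      by (intro div_diff_mem_sup_ball_1 path_nth_mem_sup_ball) auto
  qed
  then show ?thesis
    by (auto simp: coarse_walks_def coarse_steps_def)
qed

lemma sum_coarse_steps:
  assumes "p ! 0 = origin" "k \<le> (length p - 1) div l"
  shows "(\<Sum>j<k. (coarse_steps l p ! j) i) = (p ! (k * l)) i div int l"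
proof -
  have "(\<Sum>j<k. (coarse_steps l p ! j) i)
      = (\<Sum>j<k. (p ! (Suc j * l)) i div int l - (p ! (j * l)) i div int l)"
    using assms(2) by (intro sum.cong) (auto simp: coarse_steps_def)
  also have "\<dots> = (p ! (k * l)) i div int l - (p ! (0 * l)) i div int l"
    by (rule sum_lessThan_telescope)
  finally show ?thesis
    using assms(1) by (simp add: origin_def)
qed

lemma path_subset_coarse_region:
  assumes "is_path d p" "hd p = origin" "0 < l"
  shows "set p \<subseteq> coarse_region d l (coarse_steps l p)"
proof
  fix x assume "x \<in> set p"
  then obtain j where j: "j < length p" "x = p ! j"
    by (auto simp: in_set_conv_nth)
  define k where "k = j div l"
  have k: "k \<le> (length p - 1) div l"
    unfolding k_def using j(1) by (intro div_le_mono) simp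
  have "p ! 0 = origin"
    using assms(1,2) by (simp add: is_path_def hd_conv_nth)
  note sum_steps = sum_coarse_steps[OF this k]
  have "j - k * l \<le> l"
    using assms(3) by (simp add: k_def minus_div_mult_eq_mod less_imp_le)
  then have "x \<in> sup_ball d (p ! (k * l)) l"
    unfolding j(2) by (intro path_nth_mem_sup_ball assms(1) j(1)) (simp_all add: k_def)
  then have "x \<in> sup_ball d (\<lambda>i. int l * (\<Sum>j<k. (coarse_steps l p ! j) i)) (2 * l)"
    unfolding sum_steps using assms(3) by (rule mem_sup_ball_div)
  moreover have "k \<le> length (coarse_steps l p)"
    using k by (simp add: coarse_steps_def)
  ultimately show "x \<in> coarse_region d l (coarse_steps l p)"
    unfolding coarse_region_def by blast
qed

section \<open>Measurability\<close>

lemma countable_lattice: "countable (lattice d)"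
proof (rule countable_subset)
  show "lattice d \<subseteq> range (\<lambda>xs i. if i < length xs then xs ! i else 0)"
  proof
    fix x assume "x \<in> lattice d"
    then show "x \<in> range (\<lambda>xs i. if i < length xs then xs ! i else 0)"
      by (intro range_eqI[of _ _ "map x [0..<d]"]) (auto simp: lattice_def)
  qed
qed simp

lemma countable_Collect_is_path: "countable {p. is_path d p}"
proof (rule countable_subset)
  show "{p. is_path d p} \<subseteq> lists (lattice d)"
    by (auto simp: is_path_def)
qed (simp add: countable_lattice)

lemma countable_paths: "countable (paths d x y)"
  by (rule countable_subset[OF _ countable_Collect_is_path]) (auto simp: paths_def)

lemma countable_origin_paths: "countable (origin_paths d n)"
  by (rule countable_subset[OF _ countable_Collect_is_path]) (auto simp: origin_paths_def)

lemma borel_measurable_card_Collect: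
  assumes "finite I" and [measurable]: "\<And>i. i \<in> I \<Longrightarrow> Measurable.pred M (P i)"
  shows "(\<lambda>\<omega>. real (card {i \<in> I. P i \<omega>})) \<in> borel_measurable M"
proof -
  have "real (card {i \<in> I. P i \<omega>}) = (\<Sum>i\<in>I. of_bool (P i \<omega>))" for \<omega>
    using assms(1) by (simp add: Int_def)
  then show ?thesis by simp
qed

lemma Zsup_eq_SUP_paths:
  "Zsup d t N B = (SUP x\<in>{x \<in> lattice d. int N \<le> l1 d x}. SUP p\<in>paths d origin x.
      if path_T t p = passage_time d t origin x then ereal (emp t p B) else -\<infinity>)"
  (is "_ = (SUP x\<in>_. SUP p\<in>_. ?f x p)")
  unfolding Zsup_def
proof (rule SUP_cong[OF refl], rule antisym; rule SUP_least)
  fix x p assume "p \<in> geodesics d t origin x"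
  then show "ereal (emp t p B) \<le> (SUP p\<in>paths d origin x. ?f x p)"
    by (intro SUP_upper2[of p]) (auto simp: geodesics_def)
next
  fix x p assume "p \<in> paths d origin x"
  then show "?f x p \<le> (SUP p\<in>geodesics d t origin x. ereal (emp t p B))"
    by (auto intro!: SUP_upper simp: geodesics_def)
qed

context
  fixes M :: "'a measure" and d :: nat and \<tau> :: "edge \<Rightarrow> 'a \<Rightarrow> real"
  assumes measurable_weight: "\<And>e. e \<in> edges d \<Longrightarrow> \<tau> e \<in> borel_measurable M"
begin

lemma borel_measurable_path_edge:
  assumes "is_path d p" "i < length p - 1"
  shows "\<tau> {p ! i, p ! Suc i} \<in> borel_measurable M"
  using assms by (intro measurable_weight path_edge_in_edges) auto

lemma borel_measurable_path_T:
  assumes "is_path d p"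
  shows "(\<lambda>\<omega>. path_T (\<lambda>e. \<tau> e \<omega>) p) \<in> borel_measurable M"
  unfolding path_T_def
  by (intro borel_measurable_sum borel_measurable_path_edge[OF assms]) simp

lemma borel_measurable_passage_time:
  "(\<lambda>\<omega>. passage_time d (\<lambda>e. \<tau> e \<omega>) x y) \<in> borel_measurable M"
  unfolding passage_time_def
  by (intro borel_measurable_cINF_real countable_paths borel_measurable_path_T)
     (simp add: paths_def)

lemma borel_measurable_card_hits:
  assumes "is_path d p" and [measurable]: "B \<in> sets borel"
  shows "(\<lambda>\<omega>. real (card (hits (\<lambda>e. \<tau> e \<omega>) p B))) \<in> borel_measurable M"
  unfolding hits_def
proof (rule borel_measurable_card_Collect)
  fix i assume "i \<in> {..<length p - 1}"
  then have [measurable]: "\<tau> {p ! i, p ! Suc i} \<in> borel_measurable M"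
    using borel_measurable_path_edge[OF assms(1)] by simp
  show "Measurable.pred M (\<lambda>\<omega>. \<tau> {p ! i, p ! Suc i} \<omega> \<in> B)"
    by measurable
qed simp

lemma borel_measurable_emp:
  assumes "is_path d p" "B \<in> sets borel"
  shows "(\<lambda>\<omega>. emp (\<lambda>e. \<tau> e \<omega>) p B) \<in> borel_measurable M"
  unfolding emp_eq_card_hits
  by (intro borel_measurable_divide borel_measurable_card_hits assms borel_measurable_const)

lemma borel_measurable_Zsup:
  assumes "B \<in> sets borel"
  shows "(\<lambda>\<omega>. Zsup d (\<lambda>e. \<tau> e \<omega>) N B) \<in> borel_measurable M"
  unfolding Zsup_eq_SUP_paths
proof (intro borel_measurable_SUP countable_paths)
  show "countable {x \<in> lattice d. int N \<le> l1 d x}"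
    by (rule countable_subset[OF _ countable_lattice]) auto
next
  fix x p assume "p \<in> paths d origin x"
  then have "is_path d p" by (simp add: paths_def)
  note [measurable] = borel_measurable_path_T[OF this] borel_measurable_passage_time
    borel_measurable_emp[OF this assms]
  show "(\<lambda>\<omega>. if path_T (\<lambda>e. \<tau> e \<omega>) p = passage_time d (\<lambda>e. \<tau> e \<omega>) origin x
      then ereal (emp (\<lambda>e. \<tau> e \<omega>) p B) else -\<infinity>) \<in> borel_measurable M"
    by measurable
qed

end

section \<open>Probability estimates\<close>

lemma (in prob_space)
  fixes t :: real
  assumes [measurable]: "X \<in> measurable M N" "B \<in> sets N"
  shows integrable_exp_indicator: "integrable M (\<lambda>\<omega>. exp (t * indicator B (X \<omega>)))"
    and expectation_exp_indicator:
      "expectation (\<lambda>\<omega>. exp (t * indicator B (X \<omega>))) = 1 + (exp t - 1) * prob (X -` B \<inter> space M)"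
proof -
  have eq: "exp (t * indicator B (X \<omega>)) = 1 + (exp t - 1) * indicator (X -` B \<inter> space M) \<omega>"
    if "\<omega> \<in> space M" for \<omega>
    using that by (simp add: indicator_def)
  have int: "integrable M (\<lambda>\<omega>. (exp t - 1) * indicator (X -` B \<inter> space M) \<omega>)"
    by (intro integrable_mult_right integrable_real_indicator) (auto simp: less_top[symmetric])
  then show "integrable M (\<lambda>\<omega>. exp (t * indicator B (X \<omega>)))"
    by (subst Bochner_Integration.integrable_cong[OF refl eq]) auto
  show "expectation (\<lambda>\<omega>. exp (t * indicator B (X \<omega>))) = 1 + (exp t - 1) * prob (X -` B \<inter> space M)"
    using int by (subst Bochner_Integration.integral_cong[OF refl eq]) (auto simp: prob_space)
qed

lemma (in prob_space) Chernoff_card_ge: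
  fixes t :: real
  assumes indep: "indep_vars (\<lambda>_. N) X I" and "finite I"
    and B [measurable]: "B \<in> sets N" and "0 < t"
  shows "prob {\<omega> \<in> space M. a \<le> real (card {i \<in> I. X i \<omega> \<in> B})}
    \<le> exp ((exp t - 1) * (\<Sum>i\<in>I. prob (X i -` B \<inter> space M)) - t * a)"
proof -
  define Y where "Y i \<omega> = exp (t * indicator B (X i \<omega>))" for i \<omega>
  have X: "X i \<in> measurable M N" if "i \<in> I" for i
    using indep that by (auto simp: indep_vars_def)
  have indep_Y: "indep_vars (\<lambda>_. borel) Y I"
    unfolding Y_def using indep by (rule indep_vars_compose2) measurable
  have int_Y: "integrable M (Y i)" if "i \<in> I" for i
    unfolding Y_def by (rule integrable_exp_indicator[OF X[OF that] B])
  have prod_Y: "(\<Prod>i\<in>I. Y i \<omega>) = exp (t * real (card {i \<in> I. X i \<omega> \<in> B}))" for \<omega>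
  proof -
    have "(\<Sum>i\<in>I. indicator B (X i \<omega>)) = real (card {i \<in> I. X i \<omega> \<in> B})"
      using \<open>finite I\<close> by (simp add: indicator_def Int_def flip: of_bool_def)
    then show ?thesis
      unfolding Y_def using \<open>finite I\<close> by (simp flip: exp_sum sum_distrib_left)
  qed
  have "prob {\<omega> \<in> space M. a \<le> real (card {i \<in> I. X i \<omega> \<in> B})}
      = prob {\<omega> \<in> space M. exp (t * a) \<le> (\<Prod>i\<in>I. Y i \<omega>)}"
    using \<open>0 < t\<close> by (simp add: prod_Y)
  also have "\<dots> \<le> expectation (\<lambda>\<omega>. \<Prod>i\<in>I. Y i \<omega>) / exp (t * a)"
    using indep_vars_integrable[OF \<open>finite I\<close> indep_Y int_Y]
    by (intro integral_Markov_inequality_measure[where A = "{}"]) (auto simp: prod_Y)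
  also have "expectation (\<lambda>\<omega>. \<Prod>i\<in>I. Y i \<omega>) = (\<Prod>i\<in>I. expectation (Y i))"
    by (rule indep_vars_lebesgue_integral[OF \<open>finite I\<close> indep_Y int_Y])
  also have "\<dots> = (\<Prod>i\<in>I. 1 + (exp t - 1) * prob (X i -` B \<inter> space M))"
    unfolding Y_def by (intro prod.cong refl expectation_exp_indicator[OF X B])
  also have "\<dots> \<le> (\<Prod>i\<in>I. exp ((exp t - 1) * prob (X i -` B \<inter> space M)))"
    using \<open>0 < t\<close> by (intro prod_mono conjI exp_ge_add_one_self add_nonneg_nonneg) auto
  also have "\<dots> = exp ((exp t - 1) * (\<Sum>i\<in>I. prob (X i -` B \<inter> space M)))"
    using \<open>finite I\<close> by (simp add: exp_sum sum_distrib_left)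
  finally show ?thesis
    by (simp add: exp_diff divide_right_mono)
qed

lemma (in finite_measure) measure_UN_atLeast_geometric_le:
  fixes x :: real
  assumes A: "\<And>n. A n \<in> sets M" "\<And>n. measure M (A n) \<le> K * x ^ n" and x: "0 \<le> x" "x < 1"
  shows "measure M (\<Union>n\<in>{N..}. A n) \<le> K * (x ^ N / (1 - x))"
proof -
  have K: "0 \<le> K"
    using A(2)[of 0] by (simp add: order_trans[OF measure_nonneg])
  have "(\<lambda>n. K * x ^ N * x ^ n) sums (K * x ^ N * (1 / (1 - x)))"
    using x by (intro sums_mult geometric_sums) simp
  then have geom: "(\<lambda>n. K * x ^ (n + N)) sums (K * (x ^ N / (1 - x)))"
    by (simp add: power_add mult_ac)
  have "{N..} = range (\<lambda>n. n + N)"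
    by (auto simp: image_iff intro: le_add_diff_inverse2[symmetric])
  then have "emeasure M (\<Union>n\<in>{N..}. A n) = emeasure M (\<Union>n. A (n + N))"
    by (simp add: image_image)
  also have "\<dots> \<le> (\<Sum>n. emeasure M (A (n + N)))"
    using A(1) by (intro emeasure_subadditive_countably) auto
  also have "\<dots> \<le> (\<Sum>n. ennreal (K * x ^ (n + N)))"
    using A(2) by (intro suminf_le) (auto simp: emeasure_eq_measure intro: ennreal_leI)
  also have "\<dots> = ennreal (K * (x ^ N / (1 - x)))"
    using K x by (intro suminf_ennreal_eq geom) simp
  finally show ?thesis
    using K x by (simp add: emeasure_eq_measure ennreal_le_iff)
qed

lemma ex_uniform_geometric_tail:
  fixes \<theta> :: real
  assumes "0 < \<theta>"
  shows "\<exists>N>0. \<forall>s\<ge>1. exp (- (s * \<theta>)) ^ N / (1 - exp (- (s * \<theta>))) \<le> exp (- s)"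
proof -
  define b where "b = 1 - exp (- \<theta>)"
  have b: "0 < b" "b < 1" using assms by (auto simp: b_def)
  obtain N :: nat where N: "1 - ln b < real N * \<theta>"
    using reals_Archimedean3[OF assms] by blast
  have "ln b < 0" using b by simp
  then have N1: "1 < real N * \<theta>" using N by linarith
  have "exp (1 - real N * \<theta>) \<le> exp (ln b)" using N by simp
  then have exp_N: "exp (1 - real N * \<theta>) \<le> b" using b by simp
  have "exp (- (s * \<theta>)) ^ N / (1 - exp (- (s * \<theta>))) \<le> exp (- s)" if "1 \<le> s" for s
  proof -
    have "exp (- (s * \<theta>)) ^ N = exp (- s) * exp (s * (1 - real N * \<theta>))"
      by (simp add: algebra_simps flip: exp_of_nat_mult exp_add)
    also have "s * (1 - real N * \<theta>) \<le> 1 * (1 - real N * \<theta>)"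
      using N1 that by (intro mult_right_mono_neg) auto
    then have "exp (- s) * exp (s * (1 - real N * \<theta>)) \<le> exp (- s) * b"
      using exp_N by (auto intro: order_trans[rotated])
    also have "b \<le> 1 - exp (- (s * \<theta>))"
      using assms that by (simp add: b_def)
    finally show ?thesis
      using assms that by (simp add: pos_divide_le_eq)
  qed
  moreover have "0 < N" using N1 by (cases N) auto
  ultimately show ?thesis by blast
qed

lemma (in prob_space) nn_integral_le_suminf_tail:
  fixes X :: "'a \<Rightarrow> real"
  assumes [measurable]: "X \<in> borel_measurable M" and c: "0 \<le> c"
  shows "(\<integral>\<^sup>+\<omega>. ennreal (X \<omega>) \<partial>M)
    \<le> ennreal c + (\<Sum>n. emeasure M {\<omega> \<in> space M. c + real n < X \<omega>})"
proof -
  define Y where "Y \<omega> = nat \<lceil>X \<omega> - c\<rceil>" for \<omega>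
  have Y [measurable]: "Y \<in> measurable M (count_space UNIV)"
    unfolding Y_def by measurable
  have less_Y_iff: "n < Y \<omega> \<longleftrightarrow> c + real n < X \<omega>" for n \<omega>
    by (simp add: Y_def zless_nat_eq_int_zless less_ceiling_iff less_diff_eq add.commute)
  have "ennreal (X \<omega>) \<le> ennreal c + of_nat (Y \<omega>)" for \<omega>
  proof -
    have "X \<omega> \<le> c + real (Y \<omega>)" unfolding Y_def by linarith
    then have "ennreal (X \<omega>) \<le> ennreal (c + real (Y \<omega>))" by (rule ennreal_leI)
    then show ?thesis
      using c by (simp add: ennreal_of_nat_eq_real_of_nat)
  qed
  then have "(\<integral>\<^sup>+\<omega>. ennreal (X \<omega>) \<partial>M) \<le> (\<integral>\<^sup>+\<omega>. ennreal c + of_nat (Y \<omega>) \<partial>M)"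
    by (intro nn_integral_mono)
  also have "\<dots> = ennreal c + (\<Sum>n. emeasure M {\<omega> \<in> space M. n < Y \<omega>})"
    by (simp add: nn_integral_add nn_integral_nat_function[OF Y] emeasure_space_1)
  finally show ?thesis
    by (simp only: less_Y_iff)
qed

lemma (in prob_space) nn_integral_le_of_exp_tail:
  fixes X :: "'a \<Rightarrow> real"
  assumes X: "X \<in> borel_measurable M" and c: "0 \<le> c" and b: "0 < b"
    and tail: "\<And>s. c \<le> s \<Longrightarrow> prob {\<omega> \<in> space M. s < X \<omega>} \<le> C * exp (- b * s)"
  shows "(\<integral>\<^sup>+\<omega>. ennreal (X \<omega>) \<partial>M) \<le> ennreal (c + C / (1 - exp (- b)))"
proof -
  have "0 \<le> C * exp (- b * c)"
    using tail[of c] measure_nonneg order_trans by blast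
  then have C: "0 \<le> C" by (simp add: zero_le_mult_iff)
  have geom: "(\<lambda>n. C * exp (- b) ^ n) sums (C / (1 - exp (- b)))"
    using b sums_mult[OF geometric_sums[of "exp (- b)"], of C] by simp
  have tail_geom: "emeasure M {\<omega> \<in> space M. c + real n < X \<omega>} \<le> ennreal (C * exp (- b) ^ n)" for n
  proof -
    have "prob {\<omega> \<in> space M. c + real n < X \<omega>} \<le> C * exp (- b * (c + real n))"
      by (rule tail) simp
    also have "\<dots> \<le> C * exp (real n * - b)"
      using b c C by (intro mult_left_mono) (auto simp: algebra_simps)
    finally show ?thesis
      by (simp only: emeasure_eq_measure ennreal_leI exp_of_nat_mult)
  qed
  have "(\<integral>\<^sup>+\<omega>. ennreal (X \<omega>) \<partial>M) \<le> ennreal c + (\<Sum>n. ennreal (C * exp (- b) ^ n))"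
    by (intro order_trans[OF nn_integral_le_suminf_tail[OF X c]] add_left_mono suminf_le tail_geom
        summableI)
  also have "(\<Sum>n. ennreal (C * exp (- b) ^ n)) = ennreal (C / (1 - exp (- b)))"
    using C by (intro suminf_ennreal_eq geom) simp
  also have "ennreal c + \<dots> = ennreal (c + C / (1 - exp (- b)))"
    using b c C by (intro ennreal_plus[symmetric]) auto
  finally show ?thesis .
qed

section \<open>Crowded paths\<close>

text \<open>
  Per step of a coarse walk, \<open>2 * 30 ^ d\<close> is the Chernoff exponent of the edges near one ball and
  \<open>2 * d\<close> bounds the entropy \<open>ln (3 ^ d)\<close> of the choice of step.
\<close>

definition crowding_const :: "nat \<Rightarrow> real" where
  "crowding_const d = 2 * 30 ^ d + 2 * real d"

lemma crowding_const_ge_2: "2 \<le> crowding_const d"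
proof -
  have "(1 :: real) \<le> 30 ^ d" by (rule one_le_power) simp
  then show ?thesis unfolding crowding_const_def by linarith
qed

locale iid_edge_weights = prob_space M + law: prob_space \<mu>
  for M :: "'a measure" and \<mu> :: "real measure" +
  fixes d :: nat and \<tau> :: "edge \<Rightarrow> 'a \<Rightarrow> real"
  assumes indep_weights: "indep_vars (\<lambda>_. borel) \<tau> (edges d)"
    and distr_weight: "e \<in> edges d \<Longrightarrow> distr M borel (\<tau> e) = \<mu>"
begin

definition crowded_region :: "real set \<Rightarrow> nat \<Rightarrow> real \<Rightarrow> vtx list \<Rightarrow> 'a set" where
  "crowded_region B l a zs =
     {\<omega> \<in> space M. a \<le> real (card {e \<in> incident d (coarse_region d l zs). \<tau> e \<omega> \<in> B})}"

definition crowded_path :: "real set \<Rightarrow> nat \<Rightarrow> real \<Rightarrow> 'a set" where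
  "crowded_path B n a =
     {\<omega> \<in> space M. \<exists>p\<in>origin_paths d n. a \<le> real (card (hits (\<lambda>e. \<tau> e \<omega>) p B))}"

lemma measurable_weight [measurable]: "e \<in> edges d \<Longrightarrow> \<tau> e \<in> borel_measurable M"
  using indep_weights by (auto simp: indep_vars_def)

lemma prob_weight_in:
  assumes "e \<in> edges d" "B \<in> sets borel"
  shows "prob (\<tau> e -` B \<inter> space M) = measure \<mu> B"
  using measure_distr[OF measurable_weight assms(2)] distr_weight assms(1) by simp

lemma crowded_region_in_events:
  assumes [measurable]: "B \<in> sets borel"
  shows "crowded_region B l a zs \<in> events"
proof -
  have [measurable]: "(\<lambda>\<omega>. real (card {e \<in> incident d (coarse_region d l zs). \<tau> e \<omega> \<in> B}))
      \<in> borel_measurable M"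
  proof (rule borel_measurable_card_Collect)
    show "finite (incident d (coarse_region d l zs))"
      by (intro finite_incident finite_coarse_region)
    show "Measurable.pred M (\<lambda>\<omega>. \<tau> e \<omega> \<in> B)" if "e \<in> incident d (coarse_region d l zs)" for e
    proof -
      have [measurable]: "e \<in> edges d" using that by (simp add: incident_def)
      show ?thesis by measurable
    qed
  qed
  show ?thesis
    unfolding crowded_region_def by measurable
qed

lemma crowded_path_in_events:
  assumes "B \<in> sets borel"
  shows "crowded_path B n a \<in> events"
proof -
  let ?crowded = "\<lambda>p. {\<omega> \<in> space M. a \<le> real (card (hits (\<lambda>e. \<tau> e \<omega>) p B))}"
  have "?crowded p \<in> events" if "p \<in> origin_paths d n" for p
    using that assms
    by (intro borel_measurable_le borel_measurable_const borel_measurable_card_hits measurable_weight)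
       (auto simp: origin_paths_def)
  then have "(\<Union>p\<in>origin_paths d n. ?crowded p) \<in> events"
    by (intro sets.countable_UN' countable_origin_paths) auto
  also have "(\<Union>p\<in>origin_paths d n. ?crowded p) = crowded_path B n a"
    by (auto simp: crowded_path_def)
  finally show ?thesis .
qed

lemma prob_crowded_region_le:
  assumes B: "B \<in> sets borel" and scale: "0 < l" "measure \<mu> B * real l ^ d \<le> 2 ^ d"
  shows "prob (crowded_region B l a zs) \<le> exp (2 * 30 ^ d * (real (length zs) + 1) - a)"
proof -
  define E where "E = incident d (coarse_region d l zs)"
  have fin_E: "finite E" and E_sub: "E \<subseteq> edges d"
    unfolding E_def by (intro finite_incident finite_coarse_region) (auto simp: incident_def)
  have "real (card E) \<le> real ((length zs + 1) * (15 * l) ^ d)"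
    unfolding E_def using scale(1) by (intro of_nat_mono card_incident_coarse_region_le)
  then have "real (card E) * measure \<mu> B \<le> real ((length zs + 1) * (15 * l) ^ d) * measure \<mu> B"
    by (rule mult_right_mono) simp
  also have "\<dots> = (real (length zs) + 1) * 15 ^ d * (measure \<mu> B * real l ^ d)"
    by (simp add: power_mult_distrib algebra_simps)
  also have "\<dots> \<le> (real (length zs) + 1) * 15 ^ d * 2 ^ d"
    using scale(2) by (intro mult_left_mono) auto
  also have "\<dots> = (real (length zs) + 1) * (15 * 2) ^ d"
    by (simp only: power_mult_distrib mult.assoc)
  finally have mean: "real (card E) * measure \<mu> B \<le> 30 ^ d * (real (length zs) + 1)"
    by (simp add: mult.commute)
  have "prob (crowded_region B l a zs)
      \<le> exp ((exp 1 - 1) * (\<Sum>e\<in>E. prob (\<tau> e -` B \<inter> space M)) - 1 * a)"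
    unfolding crowded_region_def E_def[symmetric]
    by (intro Chernoff_card_ge[OF indep_vars_subset[OF indep_weights]] fin_E E_sub B) simp
  also have "(\<Sum>e\<in>E. prob (\<tau> e -` B \<inter> space M)) = real (card E) * measure \<mu> B"
    using E_sub by (simp add: prob_weight_in[OF _ B] subset_iff)
  also have "(exp 1 - 1) * (real (card E) * measure \<mu> B) \<le> 2 * (30 ^ d * (real (length zs) + 1))"
    using exp_le by (intro mult_mono[OF _ mean]) auto
  finally show ?thesis by (simp add: mult.assoc)
qed

lemma crowded_path_subset:
  assumes "0 < l"
  shows "crowded_path B n a \<subseteq> (\<Union>zs\<in>coarse_walks d (n div l). crowded_region B l a zs)"
proof
  fix \<omega> assume "\<omega> \<in> crowded_path B n a"
  then obtain p where \<omega>: "\<omega> \<in> space M" and p: "is_path d p" "hd p = origin" "length p = Suc n"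
    and a: "a \<le> real (card (hits (\<lambda>e. \<tau> e \<omega>) p B))"
    by (auto simp: crowded_path_def origin_paths_def)
  have "card (hits (\<lambda>e. \<tau> e \<omega>) p B)
      \<le> card {e \<in> incident d (coarse_region d l (coarse_steps l p)). \<tau> e \<omega> \<in> B}"
    using p assms by (intro card_hits_le path_subset_coarse_region finite_coarse_region)
  with a \<omega> have "\<omega> \<in> crowded_region B l a (coarse_steps l p)"
    by (simp add: crowded_region_def)
  moreover have "coarse_steps l p \<in> coarse_walks d (n div l)"
    using coarse_steps_in_coarse_walks[OF p(1) assms] p(3) by simp
  ultimately show "\<omega> \<in> (\<Union>zs\<in>coarse_walks d (n div l). crowded_region B l a zs)"
    by blast
qed

lemma prob_crowded_path_le_coarse:
  assumes B: "B \<in> sets borel" and scale: "0 < l" "measure \<mu> B * real l ^ d \<le> 2 ^ d"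
  shows "prob (crowded_path B n a) \<le> exp (crowding_const d * (real (n div l) + 1) - a)"
proof -
  define r where "r = n div l"
  have "prob (crowded_path B n a) \<le> prob (\<Union>zs\<in>coarse_walks d r. crowded_region B l a zs)"
    unfolding r_def using crowded_path_subset[OF scale(1)] finite_coarse_walks
    by (intro finite_measure_mono sets.finite_UN crowded_region_in_events[OF B])
  also have "\<dots> \<le> (\<Sum>zs\<in>coarse_walks d r. prob (crowded_region B l a zs))"
    using finite_coarse_walks crowded_region_in_events[OF B]
    by (intro finite_measure_subadditive_finite) auto
  also have "\<dots> \<le> (\<Sum>zs\<in>coarse_walks d r. exp (2 * 30 ^ d * (real r + 1) - a))"
    using prob_crowded_region_le[OF B scale] by (intro sum_mono) (auto simp: coarse_walks_def)
  also have "\<dots> = 3 ^ (d * r) * exp (2 * 30 ^ d * (real r + 1) - a)"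
    by (simp add: card_coarse_walks)
  also have "\<dots> \<le> exp 2 ^ (d * r) * exp (2 * 30 ^ d * (real r + 1) - a)"
    using exp_ge_add_one_self[of "2 :: real"] by (intro mult_right_mono power_mono) auto
  also have "\<dots> = exp (2 * real d * real r + (2 * 30 ^ d * (real r + 1) - a))"
    by (simp add: mult_ac flip: exp_of_nat_mult exp_add)
  also have "\<dots> \<le> exp (crowding_const d * (real r + 1) - a)"
    by (simp add: crowding_const_def algebra_simps)
  finally show ?thesis by (simp add: r_def)
qed

lemma prob_crowded_path_le:
  assumes B: "B \<in> sets borel" and q: "0 < q" "q \<le> 1" "measure \<mu> B = q ^ d"
  shows "prob (crowded_path B n a) \<le> exp (crowding_const d * (real n * q + 1) - a)"
proof -
  define l where "l = nat \<lceil>1 / q\<rceil>"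
  have "1 \<le> 1 / q" using q by simp
  then have l: "1 / q \<le> real l" "real l \<le> 2 / q" "0 < l"
    unfolding l_def by linarith+
  have "(q * real l) ^ d \<le> 2 ^ d"
    using q l(2) by (intro power_mono) (auto simp: field_simps)
  then have scale: "measure \<mu> B * real l ^ d \<le> 2 ^ d"
    by (simp add: q(3) power_mult_distrib)
  have "real (n div l) \<le> real n / real l"
    by (rule of_nat_div_le_of_nat)
  also have "\<dots> \<le> real n / (1 / q)"
    using l q by (intro divide_left_mono) auto
  finally have "crowding_const d * (real (n div l) + 1) \<le> crowding_const d * (real n * q + 1)"
    using crowding_const_ge_2[of d] by (intro mult_left_mono) auto
  then show ?thesis
    using prob_crowded_path_le_coarse[OF B l(3) scale, of n a] by (simp add: order_trans)
qed

lemma Zsup_gt_subset_crowded_path: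
  assumes "0 < N"
  shows "{\<omega> \<in> space M. Zsup d (\<lambda>e. \<tau> e \<omega>) N B > ereal b} \<subseteq> (\<Union>n\<in>{N..}. crowded_path B n (b * real n))"
proof
  fix \<omega> assume "\<omega> \<in> {\<omega> \<in> space M. Zsup d (\<lambda>e. \<tau> e \<omega>) N B > ereal b}"
  then obtain x p where \<omega>: "\<omega> \<in> space M" and x: "int N \<le> l1 d x"
    and p: "p \<in> paths d origin x" and gt: "b < emp (\<lambda>e. \<tau> e \<omega>) p B"
    by (auto simp: Zsup_def less_SUP_iff geodesics_def)
  have len: "N \<le> length p - 1"
    using l1_le_path_length[OF p] x by linarith
  then have "b * real (length p - 1) \<le> real (card (hits (\<lambda>e. \<tau> e \<omega>) p B))"
    using gt assms by (simp add: emp_eq_card_hits pos_less_divide_eq)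
  moreover have "p \<in> origin_paths d (length p - 1)"
    using p by (auto simp: origin_paths_def paths_def is_path_def)
  ultimately have "\<omega> \<in> crowded_path B (length p - 1) (b * real (length p - 1))"
    unfolding crowded_path_def using \<omega> by blast
  with len show "\<omega> \<in> (\<Union>n\<in>{N..}. crowded_path B n (b * real n))"
    by blast
qed

lemma prob_Zsup_gt_le_geometric:
  assumes B: "B \<in> sets borel" and q: "0 < q" "q \<le> 1" "measure \<mu> B = q ^ d"
    and N: "0 < N" and s: "2 * crowding_const d \<le> s"
  defines "x \<equiv> exp (- (s * (q / 2)))"
  shows "prob {\<omega> \<in> space M. Zsup d (\<lambda>e. \<tau> e \<omega>) N B > ereal (s * q)}
    \<le> exp (crowding_const d) * (x ^ N / (1 - x))"
proof -
  have "prob (crowded_path B n (s * q * real n)) \<le> exp (crowding_const d) * x ^ n" for n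
  proof -
    have "crowding_const d * (real n * q) \<le> s / 2 * (real n * q)"
      using q s by (intro mult_right_mono) auto
    then have "crowding_const d * (real n * q + 1) - s * q * real n
        \<le> crowding_const d + real n * - (s * (q / 2))"
      by (simp add: algebra_simps)
    then have "exp (crowding_const d * (real n * q + 1) - s * q * real n)
        \<le> exp (crowding_const d) * x ^ n"
      unfolding x_def by (simp flip: exp_of_nat_mult exp_add)
    with prob_crowded_path_le[OF B q] show ?thesis
      by (rule order_trans)
  qed
  moreover have "0 \<le> x" "x < 1"
    using q(1) s crowding_const_ge_2[of d] by (auto simp: x_def intro!: mult_pos_pos)
  ultimately have "prob (\<Union>n\<in>{N..}. crowded_path B n (s * q * real n))
      \<le> exp (crowding_const d) * (x ^ N / (1 - x))"
    by (intro measure_UN_atLeast_geometric_le crowded_path_in_events B)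
  moreover have "(\<Union>n\<in>{N..}. crowded_path B n (s * q * real n)) \<in> events"
    using crowded_path_in_events[OF B] by (intro sets.countable_UN') auto
  ultimately show ?thesis
    using finite_measure_mono[OF Zsup_gt_subset_crowded_path[OF N, of "s * q" B]] by simp
qed

lemma nn_integral_Zsup_le_of_exp_tail:
  assumes B: "B \<in> sets borel" and q: "0 < q" and c: "0 \<le> c"
    and tail: "\<And>s. c \<le> s \<Longrightarrow>
      prob {\<omega> \<in> space M. Zsup d (\<lambda>e. \<tau> e \<omega>) N B > ereal (s * q)} \<le> C * exp (- s)"
  shows "(\<integral>\<^sup>+\<omega>. e2ennreal (Zsup d (\<lambda>e. \<tau> e \<omega>) N B) \<partial>M) \<le> ennreal ((c + C / (1 - exp (- 1))) * q)"
proof -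
  define Z where "Z \<omega> = Zsup d (\<lambda>e. \<tau> e \<omega>) N B" for \<omega>
  define X where "X \<omega> = real_of_ereal (Z \<omega>) / q" for \<omega>
  have Z [measurable]: "Z \<in> borel_measurable M"
    unfolding Z_def by (rule borel_measurable_Zsup[OF measurable_weight B])
  have X [measurable]: "X \<in> borel_measurable M"
    unfolding X_def by measurable
  have Z_le: "Z \<omega> \<le> 1" for \<omega>
    unfolding Z_def by (rule Zsup_le_1)
  have "s < X \<omega> \<longleftrightarrow> ereal (s * q) < Z \<omega>" if "c \<le> s" for s \<omega>
  proof -
    have "0 \<le> s" using c that by simp
    then show ?thesis
      using Z_le[of \<omega>] q by (cases "Z \<omega>") (auto simp: X_def pos_less_divide_eq mult_less_0_iff)
  qed
  then have X_tail: "prob {\<omega> \<in> space M. s < X \<omega>} \<le> C * exp (- 1 * s)" if "c \<le> s" for s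
    using tail[OF that] that by (simp add: Z_def)
  \<comment> \<open>\<open>Z \<omega> = -\<infinity>\<close> if there is no geodesic; both \<open>e2ennreal\<close> and \<open>real_of_ereal\<close> then give \<open>0\<close>.\<close>
  have "e2ennreal (Z \<omega>) = ennreal q * ennreal (X \<omega>)" for \<omega>
    using Z_le[of \<omega>] q
    by (cases "Z \<omega>") (auto simp: X_def e2ennreal_neg simp flip: ennreal_mult')
  then have "(\<integral>\<^sup>+\<omega>. e2ennreal (Z \<omega>) \<partial>M) = ennreal q * (\<integral>\<^sup>+\<omega>. ennreal (X \<omega>) \<partial>M)"
    by (simp add: nn_integral_cmult)
  also have "\<dots> \<le> ennreal q * ennreal (c + C / (1 - exp (- 1)))"
    by (intro mult_left_mono nn_integral_le_of_exp_tail X c zero_less_one X_tail) auto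
  also have "\<dots> = ennreal ((c + C / (1 - exp (- 1))) * q)"
    using q by (simp add: mult.commute flip: ennreal_mult')
  finally show ?thesis by (simp add: Z_def)
qed

theorem ex_Zsup_tail_expectation_le:
  assumes "0 < d" and B: "B \<in> sets borel" and pos: "0 < measure \<mu> B"
  shows "\<exists>N.
    (\<lambda>\<omega>. Zsup d (\<lambda>e. \<tau> e \<omega>) N B) \<in> borel_measurable M \<and>
    (\<forall>s > 2 * crowding_const d.
      prob {\<omega> \<in> space M. Zsup d (\<lambda>e. \<tau> e \<omega>) N B > ereal (s * measure \<mu> B powr (1 / real d))}
        \<le> exp (crowding_const d) * exp (- s)) \<and>
    (\<integral>\<^sup>+\<omega>. e2ennreal (Zsup d (\<lambda>e. \<tau> e \<omega>) N B) \<partial>M)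
      \<le> ennreal ((2 * crowding_const d + exp (crowding_const d) / (1 - exp (- 1)))
          * measure \<mu> B powr (1 / real d))"
proof -
  define q where "q = measure \<mu> B powr (1 / real d)"
  have q: "0 < q" "q \<le> 1" "measure \<mu> B = q ^ d"
    using \<open>0 < d\<close> pos by (auto simp: q_def powr_le1 powr_realpow[symmetric] powr_powr)
  obtain N where "0 < N"
    and N: "\<And>s. 1 \<le> s \<Longrightarrow> exp (- (s * (q / 2))) ^ N / (1 - exp (- (s * (q / 2)))) \<le> exp (- s)"
    using ex_uniform_geometric_tail[of "q / 2"] q(1) by auto
  have tail: "prob {\<omega> \<in> space M. Zsup d (\<lambda>e. \<tau> e \<omega>) N B > ereal (s * q)}
      \<le> exp (crowding_const d) * exp (- s)" if s: "2 * crowding_const d \<le> s" for s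
  proof -
    have "1 \<le> s" using s crowding_const_ge_2[of d] by linarith
    then show ?thesis
      by (intro order_trans[OF prob_Zsup_gt_le_geometric[OF B q \<open>0 < N\<close> s]] mult_left_mono N) auto
  qed
  have "0 \<le> 2 * crowding_const d"
    using crowding_const_ge_2[of d] by linarith
  from nn_integral_Zsup_le_of_exp_tail[OF B q(1) this tail]
  have "(\<integral>\<^sup>+\<omega>. e2ennreal (Zsup d (\<lambda>e. \<tau> e \<omega>) N B) \<partial>M)
      \<le> ennreal ((2 * crowding_const d + exp (crowding_const d) / (1 - exp (- 1))) * q)" .
  moreover note borel_measurable_Zsup[OF measurable_weight B]
  ultimately show ?thesis
    unfolding q_def[symmetric] using tail by (intro exI[of _ N]) simp
qed

end

theorem theorem2p4:
  fixes d :: nat and \<mu> :: "real measure"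
  assumes "d \<ge> 2"
    and "prob_space \<mu>" and "sets \<mu> = sets borel" and "measure \<mu> {..<0} = 0"
    and "ess_inf_law \<mu> = 0 \<longrightarrow> cdf \<mu> (ess_inf_law \<mu>) < p_c d"
    and "ess_inf_law \<mu> > 0 \<longrightarrow> cdf \<mu> (ess_inf_law \<mu>) < vp_c d"
  shows "\<exists>C7 C8 C9 C3'. C7 > 0 \<and> C8 > 0 \<and> C9 > 0 \<and> C3' > 0 \<and>
    (\<forall>(M :: 'a measure) (\<tau> :: edge \<Rightarrow> 'a \<Rightarrow> real).
       prob_space M \<and>
       (\<forall>e\<in>edges d. \<forall>\<omega>\<in>space M. \<tau> e \<omega> \<ge> 0) \<and>
       (\<forall>e\<in>edges d. distr M borel (\<tau> e) = \<mu>) \<and>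
       prob_space.indep_vars M (\<lambda>_. borel) \<tau> (edges d)
     \<longrightarrow>
       (\<forall>B \<in> sets borel. measure \<mu> B > 0 \<longrightarrow>
          (\<exists>N :: nat.
             (\<lambda>\<omega>. Zsup d (\<lambda>e. \<tau> e \<omega>) N B) \<in> borel_measurable M \<and>
             (\<forall>s > C7.
                measure M {\<omega> \<in> space M. Zsup d (\<lambda>e. \<tau> e \<omega>) N B
                                         > ereal (s * measure \<mu> B powr (1 / real d))}
                  \<le> C8 * exp (- C9 * s)) \<and>
             (\<integral>\<^sup>+ \<omega>. e2ennreal (Zsup d (\<lambda>e. \<tau> e \<omega>) N B) \<partial>M)
                  \<le> ennreal (C3' * measure \<mu> B powr (1 / real d)))))"
proof -
  let ?K = "crowding_const d"
  let ?C3' = "2 * ?K + exp ?K / (1 - exp (- 1))"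
  have pos: "0 < 2 * ?K" "0 < exp ?K" "0 < (1 :: real)" "0 < ?C3'"
    using crowding_const_ge_2[of d] by (auto intro!: add_pos_pos)
  have "0 < d" using assms(1) by simp
  have iid: "iid_edge_weights M \<mu> d \<tau>"
    if "prob_space M" "\<forall>e\<in>edges d. distr M borel (\<tau> e) = \<mu>"
      "prob_space.indep_vars M (\<lambda>_. borel) \<tau> (edges d)"
    for M :: "'a measure" and \<tau>
    using that assms(2) by (simp add: iid_edge_weights_def iid_edge_weights_axioms_def)
  show ?thesis
    by (rule exI[of _ "2 * ?K"], rule exI[of _ "exp ?K"], rule exI[of _ 1], rule exI[of _ ?C3'],
        unfold mult_minus1)
       (intro conjI allI impI ballI pos, elim conjE,
        rule iid_edge_weights.ex_Zsup_tail_expectation_le[OF iid \<open>0 < d\<close>])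
qed

end
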